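(* Let $A$ be a real symmetric matrix with spectral decomposition $A=\sum_r\theta_rE_r$, and let $U(t)=\exp(itA)$. Suppose $P$ and $Q$ are real density matrices (of the same size as $A$) and $t$ is a real number such that $U(t)PU(-t)=Q$. Then: (a) $E_rPE_r=E_rQE_r$ for all $r$. (b) For all $r,s$, if $t(\theta_r-\theta_s)$ is not an integer multiple of $\pi$, then $E_rPE_s=E_rQE_s=0$. (c) For all other pairs $r,s$, $E_rPE_s=\pm E_rQE_s$.
   Context: A density matrix is a positive semidefinite (Hermitian) matrix with trace $1$. In the spectral decomposition $A=\sum_r\theta_rE_r$, the $\theta_r$ are the distinct eigenvalues of $A$ and $E_r$ is the matrix of orthogonal projection onto the $\theta_r$-eigenspace. The sign in (c) may depend on $(r,s)$. *)

theory Defs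
  imports "HOL-Analysis.Analysis"
begin

text \<open>
  On \<open>'a ^ 'n ^ 'n\<close> the class operations \<open>*\<close> and \<open>^\<close> act entrywise, and the type is not a
  normed algebra for the matrix product \<open>**\<close>.  So matrix powers, and the exponential given by the
  power series \<open>\<Sum>k. M\<^sup>k / k!\<close>, are introduced separately.
\<close>

primrec matrix_pow :: "'a::semiring_1 ^ 'n ^ 'n \<Rightarrow> nat \<Rightarrow> 'a ^ 'n ^ 'n" where
  "matrix_pow M 0 = mat 1"
| "matrix_pow M (Suc k) = M ** matrix_pow M k"

definition matrix_exp :: "complex ^ 'n ^ 'n \<Rightarrow> complex ^ 'n ^ 'n" where
  "matrix_exp M = (\<Sum>k. (1 / fact k) *\<^sub>R matrix_pow M k)"

lemma summable_matrix_exp: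
  fixes M :: "complex ^ 'n ^ 'n"
  shows "summable (\<lambda>k. (1 / fact k) *\<^sub>R matrix_pow M k)"
proof -
  have "bilinear ((**) :: complex ^ 'n ^ 'n \<Rightarrow> complex ^ 'n ^ 'n \<Rightarrow> complex ^ 'n ^ 'n)"
    unfolding bilinear_def
  proof (intro conjI allI linearI)
    fix A B C :: "complex ^ 'n ^ 'n" and c :: real
    show "A ** (B + C) = A ** B + A ** C"
      by (rule matrix_add_ldistrib)
    show "(A + B) ** C = A ** C + B ** C"
      by (simp only: vec_eq_iff matrix_matrix_mult_def vec_lambda_beta vector_add_component
          distrib_right sum.distrib simp_thms)
    show "A ** (c *\<^sub>R B) = c *\<^sub>R (A ** B)"
      by (simp only: vec_eq_iff matrix_matrix_mult_def vec_lambda_beta vector_scaleR_component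
          mult_scaleR_right scaleR_sum_right simp_thms)
    show "(c *\<^sub>R A) ** B = c *\<^sub>R (A ** B)"
      by (simp only: vec_eq_iff matrix_matrix_mult_def vec_lambda_beta vector_scaleR_component
          mult_scaleR_left scaleR_sum_right simp_thms)
  qed
  then interpret bounded_bilinear
    "(**) :: complex ^ 'n ^ 'n \<Rightarrow> complex ^ 'n ^ 'n \<Rightarrow> complex ^ 'n ^ 'n"
    by (simp add: bilinear_conv_bounded_bilinear)
  obtain K where K: "K > 0"
    "\<And>(A :: complex ^ 'n ^ 'n) (B :: complex ^ 'n ^ 'n). norm (A ** B) \<le> norm A * norm B * K"
    using pos_bounded by blast
  define c where "c = norm M * K"
  have c: "c \<ge> 0"
    using K(1) by (simp add: c_def)
  have bound: "norm (matrix_pow M k) \<le> norm (mat 1 :: complex ^ 'n ^ 'n) * c ^ k" for k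
  proof (induction k)
    case (Suc k)
    have "norm (matrix_pow M (Suc k)) \<le> norm (matrix_pow M k) * c"
      using K(2)[of M "matrix_pow M k"] by (simp add: c_def mult_ac)
    also have "\<dots> \<le> (norm (mat 1 :: complex ^ 'n ^ 'n) * c ^ k) * c"
      using Suc c by (rule mult_right_mono)
    finally show ?case
      by (simp add: mult_ac)
  qed simp
  show ?thesis
  proof (rule summable_comparison_test'[where N = 0])
    show "summable (\<lambda>k. norm (mat 1 :: complex ^ 'n ^ 'n) * (inverse (fact k) * c ^ k))"
      by (intro summable_mult summable_exp)
    show "norm ((1 / fact k) *\<^sub>R matrix_pow M k)
      \<le> norm (mat 1 :: complex ^ 'n ^ 'n) * (inverse (fact k) * c ^ k)" for k
      using mult_left_mono[OF bound[of k], of "inverse (fact k)"]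
      by (simp add: divide_inverse mult_ac)
  qed
qed

abbreviation cmatrix :: "real ^ 'n ^ 'm \<Rightarrow> complex ^ 'n ^ 'm" where
  "cmatrix \<equiv> map_matrix complex_of_real"

definition transition_matrix :: "real ^ 'n ^ 'n \<Rightarrow> real \<Rightarrow> complex ^ 'n ^ 'n" where
  "transition_matrix A t =
     matrix_exp (map_matrix (\<lambda>a. \<i> * complex_of_real t * a) (cmatrix A))"

definition hermitian :: "complex ^ 'n ^ 'n \<Rightarrow> bool" where
  "hermitian M \<longleftrightarrow> transpose (map_matrix cnj M) = M"

text \<open>The quadratic form of a Hermitian matrix is real-valued, so taking \<open>Re\<close> loses nothing.\<close>

definition positive_semidefinite :: "complex ^ 'n ^ 'n \<Rightarrow> bool" where
  "positive_semidefinite M \<longleftrightarrow>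
     hermitian M \<and> (\<forall>v :: complex ^ 'n. 0 \<le> Re (\<Sum>i\<in>UNIV. cnj (v $ i) * (M *v v) $ i))"

definition density_matrix :: "complex ^ 'n ^ 'n \<Rightarrow> bool" where
  "density_matrix M \<longleftrightarrow> positive_semidefinite M \<and> trace M = 1"

definition eigenspace :: "real ^ 'n ^ 'n \<Rightarrow> real \<Rightarrow> (real ^ 'n) set" where
  "eigenspace A \<mu> = {v. A *v v = \<mu> *s v}"

definition eigenvalues :: "real ^ 'n ^ 'n \<Rightarrow> real set" where
  "eigenvalues A = {\<mu>. \<exists>v. v \<noteq> 0 \<and> A *v v = \<mu> *s v}"

definition orthogonal_projection_matrix :: "real ^ 'n ^ 'n \<Rightarrow> (real ^ 'n) set \<Rightarrow> bool" where
  "orthogonal_projection_matrix E S \<longleftrightarrow>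
     (\<forall>x. E *v x \<in> S \<and> (\<forall>y\<in>S. orthogonal (x - E *v x) y))"

text \<open>
  Injectivity of \<open>\<theta>\<close> says that the \<open>\<theta> r\<close> are the distinct eigenvalues, i.e. each eigenvalue
  of \<open>A\<close> is listed exactly once.
\<close>

definition spectral_decomposition ::
  "real ^ 'n ^ 'n \<Rightarrow> 'r set \<Rightarrow> ('r \<Rightarrow> real) \<Rightarrow> ('r \<Rightarrow> real ^ 'n ^ 'n) \<Rightarrow> bool" where
  "spectral_decomposition A R \<theta> E \<longleftrightarrow>
     finite R \<and> inj_on \<theta> R \<and> \<theta> ` R = eigenvalues A \<and>
     (\<forall>r\<in>R. orthogonal_projection_matrix (E r) (eigenspace A (\<theta> r))) \<and>
     A = (\<Sum>r\<in>R. \<theta> r *\<^sub>R E r)"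

end

theory Submission
  imports Defs
begin

text \<open>
  Each spectral projection absorbs the transition matrix up to a phase: since
  \<open>E\<^sub>r A = \<theta>\<^sub>r E\<^sub>r\<close> and \<open>A E\<^sub>s = \<theta>\<^sub>s E\<^sub>s\<close>, the exponential series gives
  \<open>E\<^sub>r U(t) = e\<^bsup>it\<theta>\<^sub>r\<^esup> E\<^sub>r\<close> and \<open>U(-t) E\<^sub>s = e\<^bsup>-it\<theta>\<^sub>s\<^esup> E\<^sub>s\<close>.  Multiplying
  \<open>U(t) P U(-t) = Q\<close> by \<open>E\<^sub>r\<close> on the left and by \<open>E\<^sub>s\<close> on the right therefore yields
  \<open>E\<^sub>r Q E\<^sub>s = e\<^bsup>it(\<theta>\<^sub>r - \<theta>\<^sub>s)\<^esup> E\<^sub>r P E\<^sub>s\<close>.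

  Both products are real matrices, whereas the phase is a single complex number of modulus one.
  Comparing imaginary parts (\<open>sandwich_phase\<close>), \<open>sin (t (\<theta>\<^sub>r - \<theta>\<^sub>s))\<close> annihilates \<open>E\<^sub>r P E\<^sub>s\<close>;
  comparing real parts, \<open>E\<^sub>r Q E\<^sub>s\<close> is \<open>cos (t (\<theta>\<^sub>r - \<theta>\<^sub>s))\<close> times \<open>E\<^sub>r P E\<^sub>s\<close>.  The three claims
  are the cases where the angle is zero, where its sine is nonzero, and where its sine vanishes,
  so that its cosine is \<open>1\<close> or \<open>-1\<close>.
\<close>

lemma map_matrix_times_mult_left:
  fixes M :: "'a::comm_semiring_1 ^ 'n ^ 'm" and N :: "'a ^ 'p ^ 'n"
  shows "map_matrix (\<lambda>a. c * a) M ** N = map_matrix (\<lambda>a. c * a) (M ** N)"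
  by (simp add: vec_eq_iff matrix_matrix_mult_def map_matrix_def sum_distrib_left mult.assoc)

lemma map_matrix_times_mult_right:
  fixes M :: "'a::comm_semiring_1 ^ 'n ^ 'm" and N :: "'a ^ 'p ^ 'n"
  shows "M ** map_matrix (\<lambda>a. c * a) N = map_matrix (\<lambda>a. c * a) (M ** N)"
  by (simp add: vec_eq_iff matrix_matrix_mult_def map_matrix_def sum_distrib_left mult.left_commute)

lemma cmatrix_mult:
  fixes M :: "real ^ 'n ^ 'm" and N :: "real ^ 'p ^ 'n"
  shows "cmatrix (M ** N) = cmatrix M ** cmatrix N"
  by (simp add: vec_eq_iff matrix_matrix_mult_def map_matrix_def)

lemma linear_matrix_mult_left: "linear (\<lambda>X :: complex ^ 'n ^ 'm. B ** X)"
  by (rule linearI)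
    (simp_all add: vec_eq_iff matrix_matrix_mult_def distrib_left sum.distrib scaleR_sum_right)

lemma linear_matrix_mult_right: "linear (\<lambda>X :: complex ^ 'n ^ 'm. X ** B)"
  by (rule linearI)
    (simp_all add: vec_eq_iff matrix_matrix_mult_def distrib_right sum.distrib scaleR_sum_right)

text \<open>
  A linear map may be applied to the exponential series term by term; if it turns every power
  of \<open>M\<close> into the same power of a scalar, the scalar exponential series results.  Left and
  right multiplication by a matrix of eigenvectors are both instances.
\<close>

lemma linear_matrix_exp:
  fixes L :: "complex ^ 'n ^ 'n \<Rightarrow> complex ^ 'p ^ 'm"
  assumes L: "linear L"
    and pow: "\<And>k. L (matrix_pow M k) = map_matrix (\<lambda>a. c ^ k * a) B"
  shows "L (matrix_exp M) = map_matrix (\<lambda>a. exp c * a) B"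
proof -
  have "(\<lambda>k. (1 / fact k) *\<^sub>R matrix_pow M k) sums matrix_exp M"
    unfolding matrix_exp_def by (rule summable_sums[OF summable_matrix_exp])
  from bounded_linear.sums[OF linear_conv_bounded_linear[THEN iffD1, OF L] this]
  have "(\<lambda>k. (1 / fact k) *\<^sub>R map_matrix (\<lambda>a. c ^ k * a) B) sums L (matrix_exp M)"
    by (simp add: linear_scale[OF L] pow)
  then have "(\<lambda>k. ((1 / fact k) *\<^sub>R map_matrix (\<lambda>a. c ^ k * a) B) $ i $ j)
      sums (L (matrix_exp M) $ i $ j)" for i j
    by (intro bounded_linear.sums[OF bounded_linear_vec_nth])
  moreover have "(\<lambda>k. ((1 / fact k) *\<^sub>R map_matrix (\<lambda>a. c ^ k * a) B) $ i $ j)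
      sums (exp c * B $ i $ j)" for i j
    using sums_mult2[OF exp_converges[of c], of "B $ i $ j"]
    by (simp add: map_matrix_def divide_inverse mult.assoc)
  ultimately have "L (matrix_exp M) $ i $ j = exp c * B $ i $ j" for i j
    by (rule sums_unique2)
  then show ?thesis
    by (simp add: vec_eq_iff map_matrix_def)
qed

lemma matrix_exp_mult_eigen_right:
  assumes "M ** B = map_matrix (\<lambda>a. c * a) B"
  shows "matrix_exp M ** B = map_matrix (\<lambda>a. exp c * a) B"
proof (rule linear_matrix_exp[OF linear_matrix_mult_right])
  show "matrix_pow M k ** B = map_matrix (\<lambda>a. c ^ k * a) B" for k
  proof (induction k)
    case (Suc k)
    then show ?case
      by (simp add: matrix_mul_assoc[symmetric] map_matrix_times_mult_right assms)
        (simp add: vec_eq_iff map_matrix_def mult_ac)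
  qed (simp add: vec_eq_iff map_matrix_def)
qed

lemma matrix_exp_mult_eigen_left:
  assumes "B ** M = map_matrix (\<lambda>a. c * a) B"
  shows "B ** matrix_exp M = map_matrix (\<lambda>a. exp c * a) B"
proof (rule linear_matrix_exp[OF linear_matrix_mult_left])
  show "B ** matrix_pow M k = map_matrix (\<lambda>a. c ^ k * a) B" for k
  proof (induction k)
    case (Suc k)
    then show ?case
      by (simp add: matrix_mul_assoc map_matrix_times_mult_left assms)
        (simp add: vec_eq_iff map_matrix_def mult_ac)
  qed (simp add: vec_eq_iff map_matrix_def)
qed

text \<open>
  Orthogonality of \<open>x - E x\<close> to the range gives \<open>x \<bullet> E y = E x \<bullet> E y\<close>, and the right-hand side is
  symmetric in \<open>x\<close> and \<open>y\<close>.
\<close>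

lemma orthogonal_projection_matrix_symmetric:
  assumes "orthogonal_projection_matrix E S"
  shows "transpose E = E"
proof -
  have *: "x \<bullet> (E *v y) = (E *v x) \<bullet> (E *v y)" for x y
  proof -
    have "orthogonal (x - E *v x) (E *v y)"
      using assms unfolding orthogonal_projection_matrix_def by blast
    then show ?thesis
      by (simp add: orthogonal_def inner_diff_left)
  qed
  have "x \<bullet> (transpose E *v y) = x \<bullet> (E *v y)" for x y
  proof -
    have "x \<bullet> (transpose E *v y) = y \<bullet> (E *v x)"
      by (metis dot_lmul_matrix inner_commute transpose_matrix_vector)
    also have "\<dots> = x \<bullet> (E *v y)"
      using *[of x y] *[of y x] by (metis inner_commute)
    finally show ?thesis .
  qed
  then have "transpose E *v y = E *v y" for y
    using vector_eq_ldot by blast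
  then show ?thesis
    by (simp add: matrix_eq)
qed

lemma mult_eigenspace_projection:
  assumes "orthogonal_projection_matrix E (eigenspace A \<mu>)"
  shows "A ** E = \<mu> *\<^sub>R E"
  using assms
  by (simp add: matrix_eq orthogonal_projection_matrix_def eigenspace_def
      matrix_vector_mul_assoc[symmetric] scaleR_matrix_vector_assoc[symmetric] scalar_mult_eq_scaleR)

lemma eigenspace_projection_mult:
  assumes "orthogonal_projection_matrix E (eigenspace A \<mu>)" and "transpose A = A"
  shows "E ** A = \<mu> *\<^sub>R E"
proof -
  have "E ** A = transpose (A ** E)"
    using assms orthogonal_projection_matrix_symmetric[OF assms(1)]
    by (simp add: matrix_transpose_mul)
  then show ?thesis
    using orthogonal_projection_matrix_symmetric[OF assms(1)]
    by (simp add: mult_eigenspace_projection[OF assms(1)] transpose_scalar)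
qed

lemma transition_matrix_mult_projection:
  assumes "orthogonal_projection_matrix E (eigenspace A \<mu>)"
  shows "transition_matrix A t ** cmatrix E =
    map_matrix (\<lambda>a. exp (\<i> * complex_of_real (t * \<mu>)) * a) (cmatrix E)"
  unfolding transition_matrix_def
  by (rule matrix_exp_mult_eigen_right)
    (simp add: map_matrix_times_mult_left cmatrix_mult[symmetric] mult_eigenspace_projection[OF assms],
     simp add: vec_eq_iff map_matrix_def)

lemma projection_mult_transition_matrix:
  assumes "orthogonal_projection_matrix E (eigenspace A \<mu>)" and "transpose A = A"
  shows "cmatrix E ** transition_matrix A t =
    map_matrix (\<lambda>a. exp (\<i> * complex_of_real (t * \<mu>)) * a) (cmatrix E)"
  unfolding transition_matrix_def
  by (rule matrix_exp_mult_eigen_left)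
    (simp add: map_matrix_times_mult_right cmatrix_mult[symmetric] eigenspace_projection_mult[OF assms],
     simp add: vec_eq_iff map_matrix_def)

text \<open>
  The two projections turn the conjugation by \<open>U(t)\<close> into multiplication by the phase
  \<open>e\<^bsup>it(\<mu> - \<nu>)\<^esup>\<close>.  As all entries of \<open>E P F\<close> and \<open>E Q F\<close> are real, the imaginary and real parts of
  this relation hold separately.
\<close>

lemma sandwich_phase:
  fixes A P Q E F :: "real ^ 'n ^ 'n"
  assumes A: "transpose A = A"
    and E: "orthogonal_projection_matrix E (eigenspace A \<mu>)"
    and F: "orthogonal_projection_matrix F (eigenspace A \<nu>)"
    and Q: "transition_matrix A t ** cmatrix P ** transition_matrix A (- t) = cmatrix Q"
  shows "sin (t * (\<mu> - \<nu>)) *\<^sub>R (E ** P ** F) = 0"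
    and "E ** Q ** F = cos (t * (\<mu> - \<nu>)) *\<^sub>R (E ** P ** F)"
proof -
  have "cmatrix (E ** Q ** F) =
      (cmatrix E ** transition_matrix A t) ** cmatrix P ** (transition_matrix A (- t) ** cmatrix F)"
    by (simp add: cmatrix_mult Q[symmetric] matrix_mul_assoc)
  also have "\<dots> = map_matrix (\<lambda>a. cis (t * (\<mu> - \<nu>)) * a) (cmatrix (E ** P ** F))"
    by (simp add: projection_mult_transition_matrix[OF E A] transition_matrix_mult_projection[OF F]
        map_matrix_times_mult_left map_matrix_times_mult_right cmatrix_mult)
      (simp add: vec_eq_iff map_matrix_def cis_conv_exp exp_diff exp_minus field_simps)
  finally have eq: "complex_of_real ((E ** Q ** F) $ i $ j) =
      cis (t * (\<mu> - \<nu>)) * complex_of_real ((E ** P ** F) $ i $ j)" for i j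
    by (simp add: vec_eq_iff map_matrix_def)
  show "sin (t * (\<mu> - \<nu>)) *\<^sub>R (E ** P ** F) = 0"
    using arg_cong[OF eq, of Im] by (simp add: vec_eq_iff)
  show "E ** Q ** F = cos (t * (\<mu> - \<nu>)) *\<^sub>R (E ** P ** F)"
    using arg_cong[OF eq, of Re] by (simp add: vec_eq_iff)
qed

theorem lemma2p4:
  fixes A P Q :: "real ^ 'n ^ 'n"
    and R :: "'r set" and \<theta> :: "'r \<Rightarrow> real" and E :: "'r \<Rightarrow> real ^ 'n ^ 'n"
    and t :: real
  assumes "transpose A = A"
    and "spectral_decomposition A R \<theta> E"
    and "density_matrix (cmatrix P)"
    and "density_matrix (cmatrix Q)"
    and "transition_matrix A t ** cmatrix P ** transition_matrix A (- t) = cmatrix Q"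
  shows "(\<forall>r\<in>R. E r ** P ** E r = E r ** Q ** E r) \<and>
    (\<forall>r\<in>R. \<forall>s\<in>R. \<not> (\<exists>k::int. t * (\<theta> r - \<theta> s) = of_int k * pi) \<longrightarrow>
        E r ** P ** E s = 0 \<and> E r ** Q ** E s = 0) \<and>
    (\<forall>r\<in>R. \<forall>s\<in>R. (\<exists>k::int. t * (\<theta> r - \<theta> s) = of_int k * pi) \<longrightarrow>
        E r ** P ** E s = E r ** Q ** E s \<or> E r ** P ** E s = - (E r ** Q ** E s))"
proof -
  have proj: "orthogonal_projection_matrix (E r) (eigenspace A (\<theta> r))" if "r \<in> R" for r
    using assms(2) that unfolding spectral_decomposition_def by blast
  note phase = sandwich_phase[OF assms(1) proj proj assms(5)]
  have diagonal: "E r ** P ** E r = E r ** Q ** E r" if "r \<in> R" for r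
    using phase(2)[OF that that] by simp
  have vanish: "E r ** P ** E s = 0 \<and> E r ** Q ** E s = 0"
    if "r \<in> R" "s \<in> R" "\<not> (\<exists>k::int. t * (\<theta> r - \<theta> s) = of_int k * pi)" for r s
  proof -
    have "sin (t * (\<theta> r - \<theta> s)) \<noteq> 0"
      using that(3) by (simp add: sin_zero_iff_int2)
    then have "E r ** P ** E s = 0"
      using phase(1)[OF that(1,2)] by simp
    then show ?thesis
      using phase(2)[OF that(1,2)] by simp
  qed
  have sign: "E r ** P ** E s = E r ** Q ** E s \<or> E r ** P ** E s = - (E r ** Q ** E s)"
    if "r \<in> R" "s \<in> R" "\<exists>k::int. t * (\<theta> r - \<theta> s) = of_int k * pi" for r s
  proof -
    have "sin (t * (\<theta> r - \<theta> s)) = 0"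
      using that(3) by (simp add: sin_zero_iff_int2)
    then have "cos (t * (\<theta> r - \<theta> s)) = 1 \<or> cos (t * (\<theta> r - \<theta> s)) = - 1"
      using sin_zero_abs_cos_one by fastforce
    then show ?thesis
      using phase(2)[OF that(1,2)] by auto
  qed
  show ?thesis
    using diagonal vanish sign by blast
qed

end
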